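(* Let $m\in\mathbb{N}$, let $\alpha_j,\beta_j,\gamma,b,c\in\mathbb{C}$ $(j=1,\dots,m)$ and let $\kappa>0$, with $\sum_{j=1}^m\Re(\alpha_j)>\max\{0,\Re(\kappa)-1\}$, $\Re(\beta_j)>0$ for all $j$, and $\Re(\gamma)>0$. Let $\lambda,\delta\in\mathbb{C}$ with $\Re(\lambda)>0$ and $\Re(\delta)>[\Re(\lambda)]+1-\Re(\lambda)$, where $[\Re(\lambda)]$ is the integral part of $\Re(\lambda)$. Then for every $x>0$, $$\left(D_{-}^{\lambda}\left\{t^{-\delta}\mathcal{J}_{(\beta_j)_m,\kappa,b}^{(\alpha_j)_m,\gamma,c}\left(\frac1t\right)\right\}\right)(x)=\frac{x^{1-\lambda-\delta}}{\Gamma(\gamma)}\;{}_2\Psi_{m+1}\left[\begin{array}{c}(\gamma,\kappa),(\lambda+\delta,1)\\ \left(\beta_j+\frac{b+1}{2},\alpha_j\right)_{j=1}^m,(\delta,1)\end{array}\Big|\;\frac{c}{x}\right].$$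
   Context: The generalized multiindex Bessel function is $$\mathcal{J}_{(\beta_j)_m,\kappa,b}^{(\alpha_j)_m,\gamma,c}[z]=\sum_{n=0}^\infty\frac{c^n(\gamma)_{\kappa n}}{\prod_{j=1}^m\Gamma\left(\alpha_jn+\beta_j+\frac{b+1}{2}\right)}\frac{z^n}{n!},\qquad (\gamma)_{\nu}=\frac{\Gamma(\gamma+\nu)}{\Gamma(\gamma)}.$$ The Fox–Wright function is given by the series $${}_p\Psi_q\left[\begin{array}{c}(a_1,A_1),\dots,(a_p,A_p)\\(b_1,B_1),\dots,(b_q,B_q)\end{array}\Big|\;z\right]=\sum_{n=0}^\infty\frac{\Gamma(a_1+A_1n)\cdots\Gamma(a_p+A_pn)}{\Gamma(b_1+B_1n)\cdots\Gamma(b_q+B_qn)}\frac{z^n}{n!},$$ where some of the $B_j$ may be complex (here $B_j=\alpha_j$). Throughout, $1/\Gamma$ is the entire reciprocal Gamma function, with value $0$ at the poles of $\Gamma$. The notation $\left(\beta_j+\frac{b+1}{2},\alpha_j\right)_{j=1}^m$ stands for the list of the $m$ pairs $\left(\beta_j+\frac{b+1}{2},\alpha_j\right)$. For $\Re(\mu)>0$ and $x>0$, $(I_{-}^\mu f)(x)=\frac{1}{\Gamma(\mu)}\int_x^\infty\frac{f(t)}{(t-x)^{1-\mu}}\,dt$. The right-sided Riemann–Liouville fractional derivative is, for $\Re(\lambda)>0$ and $x>0$, $$(D_{-}^\lambda f)(x)=\left(-\frac{d}{dx}\right)^{[\Re(\lambda)]+1}\left(I_{-}^{1-\lambda+[\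Re(\lambda)]}f\right)(x).$$
   Formalization: The power of x on the right is x^{-λ-δ} instead of the printed x^{1-λ-δ}, which is false: for m=1, α=β=γ=κ=1, b=-1, c=0, λ=1, δ=2, x=2 the left side is 1/4 and the printed right side is 1/2. *)

theory Defs
  imports "HOL-Analysis.Analysis"
begin

definition gen_pochhammer :: "complex \<Rightarrow> complex \<Rightarrow> complex" where
  "gen_pochhammer g v = Gamma (g + v) / Gamma g"

(* rGamma is the entire reciprocal Gamma function, equal to 0 at the poles of Gamma. *)
definition multiindex_bessel ::
  "nat \<Rightarrow> (nat \<Rightarrow> complex) \<Rightarrow> (nat \<Rightarrow> complex) \<Rightarrow> complex \<Rightarrow> complex \<Rightarrow> complex \<Rightarrow> complex \<Rightarrow> complex \<Rightarrow> complex"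
  where
  "multiindex_bessel m \<alpha> \<beta> \<kappa> b \<gamma> c z =
     (\<Sum>n. c ^ n * gen_pochhammer \<gamma> (\<kappa> * of_nat n)
            * (\<Prod>j=1..m. rGamma (\<alpha> j * of_nat n + \<beta> j + (b + 1) / 2))
            * (z ^ n / fact n))"

definition fox_wright ::
  "(complex \<times> complex) list \<Rightarrow> (complex \<times> complex) list \<Rightarrow> complex \<Rightarrow> complex" where
  "fox_wright as bs z =
     (\<Sum>n. prod_list (map (\<lambda>(a, A). Gamma (a + A * of_nat n)) as)
            * prod_list (map (\<lambda>(b, B). rGamma (b + B * of_nat n)) bs)
            * (z ^ n / fact n))"

definition RL_integral_right :: "complex \<Rightarrow> (real \<Rightarrow> complex) \<Rightarrow> real \<Rightarrow> complex" where
  "RL_integral_right \<mu> f x =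
     1 / Gamma \<mu> * (LBINT t:{x<..}. f t / of_real (t - x) powr (1 - \<mu>))"

definition RL_deriv_right :: "complex \<Rightarrow> (real \<Rightarrow> complex) \<Rightarrow> real \<Rightarrow> complex" where
  "RL_deriv_right l f =
     ((\<lambda>g x. - vector_derivative g (at x)) ^^ nat (\<lfloor>Re l\<rfloor> + 1))
       (RL_integral_right (1 - l + of_int \<lfloor>Re l\<rfloor>) f)"

end

theory Submission
  imports Defs "HOL-Real_Asymp.Real_Asymp"
begin

text \<open>
  Write J(1/t) as a power series in 1/t.  Crude Stirling bounds for Gamma, transferred to complex
  arguments by Euler's product and the reflection formula, show that the n-th coefficient is at most
  exp (K n - (1 + sum of Re alpha_j - kappa) n ln n), so the series is entire and may be integrated
  term by term.  The Beta integral over (x, infinity) turns t powr (-(delta + n)) into a multiple of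
  x powr (mu - delta - n), and each application of -d/dx multiplies the coefficient of x powr (-s)
  by s; the Pochhammer symbols so produced combine with the Gamma quotient of the integral to
  Gamma (lam + delta + n) / Gamma (delta + n).
\<close>

subsection \<open>Growth of the Gamma function along arithmetic progressions\<close>

lemma pochhammer_Suc_conv_prod_atMost:
  "pochhammer (z :: 'a :: comm_semiring_1) (Suc n) = (\<Prod>k\<le>n. z + of_nat k)"
  by (simp add: pochhammer_prod atLeast0LessThan lessThan_Suc_atMost)

text \<open>Holds already for the finite products in Euler's formula: each factor satisfies Re z + k
  \<le> norm (z + k), and the modulus of n powr z depends on Re z only. The limit preserves the
  inequality.\<close>

lemma rGamma_Re_le_norm_rGamma:
  assumes "Re z > 0"
  shows "rGamma (Re z) \<le> norm (rGamma z)"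
proof (rule LIMSEQ_le)
  show "rGamma_series (Re z) \<longlonglongrightarrow> rGamma (Re z)"
    by (rule rGamma_series_LIMSEQ)
  show "(\<lambda>n. norm (rGamma_series z n)) \<longlonglongrightarrow> norm (rGamma z)"
    by (intro tendsto_norm rGamma_series_LIMSEQ)
  have "rGamma_series (Re z) n \<le> norm (rGamma_series z n)" for n
  proof -
    have "(\<Prod>k\<le>n. Re z + real k) \<le> (\<Prod>k\<le>n. norm (z + of_nat k))"
      using assms complex_Re_le_cmod[of "z + of_nat k" for k] by (intro prod_mono) auto
    thus ?thesis
      by (simp add: rGamma_series_def pochhammer_Suc_conv_prod_atMost norm_divide norm_mult
            prod_norm [symmetric] divide_right_mono)
  qed
  thus "\<exists>N. \<forall>n\<ge>N. rGamma_series (Re z) n \<le> norm (rGamma_series z n)" by blast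
qed

lemma norm_Gamma_le_Gamma_Re:
  assumes "Re z > 0"
  shows "norm (Gamma z) \<le> Gamma (Re z)"
proof -
  have "norm (Gamma z) = inverse (norm (rGamma z))"
    by (simp add: rGamma_inverse_Gamma norm_inverse)
  also have "\<dots> \<le> inverse (rGamma (Re z))"
    using rGamma_Re_le_norm_rGamma[OF assms] assms
    by (intro le_imp_inverse_le) (auto simp: rGamma_inverse_Gamma)
  finally show ?thesis by (simp add: rGamma_inverse_Gamma)
qed

lemma norm_sin_le_exp: "norm (sin z) \<le> exp \<bar>Im z\<bar>" for z :: complex
proof -
  have "norm (sin z) \<le> (norm (exp (\<i> * z)) + norm (exp (- (\<i> * z)))) / 2"
    using norm_triangle_ineq4[of "exp (\<i> * z)" "exp (- (\<i> * z))"]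
    unfolding sin_exp_eq by (simp add: norm_divide norm_mult)
  also have "\<dots> \<le> (exp \<bar>Im z\<bar> + exp \<bar>Im z\<bar>) / 2"
    by (intro divide_right_mono add_mono) auto
  also have "\<dots> = exp \<bar>Im z\<bar>"
    by simp
  finally show ?thesis .
qed

text \<open>Reflection gives 1 / Gamma z = Gamma (1 - z) sin (pi z) / pi. Here 1 - z lies in the
  right half-plane, where Gamma is bounded by its value at the real part; the sine costs the
  exponential factor.\<close>

lemma norm_rGamma_le_left:
  assumes "Re z \<le> 1/2"
  shows "norm (rGamma z) \<le> exp (pi * \<bar>Im z\<bar>) * Gamma (1 - Re z) / pi"
proof -
  have "rGamma z = Gamma (1 - z) * sin (of_real pi * z) / of_real pi"
  proof -
    have "1 - z \<notin> \<int>\<^sub>\<le>\<^sub>0" using assms by (auto elim!: nonpos_Ints_cases simp: complex_eq_iff)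
    hence "Gamma (1 - z) \<noteq> 0" by (simp add: Gamma_eq_zero_iff)
    with rGamma_reflection_complex[of z] show ?thesis
      by (simp add: rGamma_inverse_Gamma[of "1 - z"] field_simps)
  qed
  hence "norm (rGamma z) = norm (sin (of_real pi * z)) * norm (Gamma (1 - z)) / pi"
    by (simp add: norm_mult norm_divide mult.commute)
  also have "\<dots> \<le> exp (pi * \<bar>Im z\<bar>) * Gamma (1 - Re z) / pi"
    using norm_sin_le_exp[of "of_real pi * z"] norm_Gamma_le_Gamma_Re[of "1 - z"] assms
    by (intro divide_right_mono mult_mono) (auto simp: abs_mult)
  finally show ?thesis .
qed

lemma norm_rGamma_le_right:
  assumes "Re z \<ge> 1/2"
  shows "norm (rGamma z) \<le> exp (pi * \<bar>Im z\<bar>) / Gamma (Re z)"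
proof -
  \<comment> \<open>Factor by factor in Euler's product, |rGamma z| / rGamma (Re z) decreases as Re z grows
      with Im z fixed, so the bound for Re w = 1/2 obtained by reflection carries over.\<close>
  define w where "w = Complex (1/2) (Im z)"
  have "norm (rGamma z) * rGamma (1/2) \<le> rGamma (Re z) * norm (rGamma w)"
  proof (rule LIMSEQ_le)
    show "(\<lambda>n. norm (rGamma_series z n) * rGamma_series (1/2) n)
            \<longlonglongrightarrow> norm (rGamma z) * rGamma (1/2)"
      by (intro tendsto_intros)
    show "(\<lambda>n. rGamma_series (Re z) n * norm (rGamma_series w n))
            \<longlonglongrightarrow> rGamma (Re z) * norm (rGamma w)"
      by (intro tendsto_intros)
    \<comment> \<open>After squaring, the product (Re z + k)^2 (1/2 + k)^2 occurs on both sides, and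
      only the comparison of the coefficients of (Im z)^2 remains.\<close>
    have factor: "norm (z + of_nat k) * (1/2 + real k) \<le> (Re z + real k) * norm (w + of_nat k)" for k
    proof (rule power2_le_imp_le)
      have "(1/2 + real k)^2 \<le> (Re z + real k)^2"
        using assms by (intro power_mono) auto
      hence "(1/2 + real k)^2 * (Im z)^2 \<le> (Re z + real k)^2 * (Im z)^2"
        by (intro mult_right_mono) auto
      hence "((Re z + real k)^2 + (Im z)^2) * (1/2 + real k)^2
               \<le> (Re z + real k)^2 * ((1/2 + real k)^2 + (Im z)^2)"
        by (simp add: ring_distribs(1,2) mult.commute)
      thus "(norm (z + of_nat k) * (1/2 + real k))\<^sup>2 \<le> ((Re z + real k) * norm (w + of_nat k))\<^sup>2"
        unfolding power_mult_distrib cmod_power2 by (simp add: w_def)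
    qed (use assms in auto)
    have "norm (rGamma_series z n) * rGamma_series (1/2) n
            \<le> rGamma_series (Re z) n * norm (rGamma_series w n)" for n
    proof -
      have "(\<Prod>k\<le>n. norm (z + of_nat k) * (1/2 + real k))
              \<le> (\<Prod>k\<le>n. (Re z + real k) * norm (w + of_nat k))"
        by (intro prod_mono conjI factor) auto
      thus ?thesis
        by (simp add: rGamma_series_def pochhammer_Suc_conv_prod_atMost norm_divide norm_mult
              prod_norm [symmetric] prod.distrib w_def divide_right_mono mult_ac)
    qed
    thus "\<exists>N. \<forall>n\<ge>N. norm (rGamma_series z n) * rGamma_series (1/2) n
            \<le> rGamma_series (Re z) n * norm (rGamma_series w n)" by blast
  qed
  also have "\<dots> \<le> rGamma (Re z) * (exp (pi * \<bar>Im z\<bar>) * Gamma (1/2) / pi)"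
  proof (rule mult_left_mono)
    show "norm (rGamma w) \<le> exp (pi * \<bar>Im z\<bar>) * Gamma (1/2) / pi"
      using norm_rGamma_le_left[of w] by (simp add: w_def)
    show "rGamma (Re z) \<ge> 0"
      using assms by (simp add: rGamma_inverse_Gamma)
  qed
  also have "rGamma (1/2 :: real) = 1 / sqrt pi"
    by (simp add: rGamma_inverse_Gamma Gamma_one_half_real inverse_eq_divide)
  also have "Gamma (1/2 :: real) = sqrt pi"
    by (rule Gamma_one_half_real)
  finally have "norm (rGamma z) * (1 / sqrt pi) \<le> rGamma (Re z) * exp (pi * \<bar>Im z\<bar>) * (sqrt pi / pi)"
    by (simp add: mult.assoc)
  \<comment> \<open>Because Gamma (1/2) = sqrt pi, the same factor 1 / sqrt pi stands on both sides
    and cancels, so the final bound has no constant.\<close>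
  also have "sqrt pi / pi = 1 / sqrt pi"
    by (simp add: frac_eq_eq)
  finally have "norm (rGamma z) \<le> rGamma (Re z) * exp (pi * \<bar>Im z\<bar>)"
    by (rule mult_right_le_imp_le) simp
  also have "rGamma (Re z) = 1 / Gamma (Re z)"
    by (simp add: rGamma_inverse_Gamma inverse_eq_divide)
  finally show ?thesis by simp
qed

section \<open>Crude Stirling bounds on the real line\<close>

text \<open>In Euler's integral only t \<ge> y is kept, where t powr y \<ge> y powr y; the rest is
  the integral of exp (-t) from y on.\<close>

lemma Gamma_plus1_ge:
  assumes "y > (0::real)"
  shows "exp (y * ln y - y) \<le> Gamma (y + 1)"
proof (rule has_integral_le)
  have "((\<lambda>t. y powr y * exp (-1 * t)) has_integral y powr y * (exp (-1 * y) / 1)) {y..}"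
    using has_integral_exp_minus_to_infinity[of 1 y] by (intro has_integral_mult_right) auto
  hence "((\<lambda>t. if t \<in> {y..} then y powr y * exp (-1 * t) else 0) has_integral y powr y * (exp (-1 * y) / 1)) {0..}"
    using assms by (subst has_integral_restrict) auto
  thus "((\<lambda>t. if t \<in> {y..} then y powr y * exp (-1 * t) else 0) has_integral exp (y * ln y - y)) {0..}"
    using assms by (simp add: powr_def exp_diff exp_minus field_simps)
  show "((\<lambda>t. t powr (y + 1 - 1) / exp t) has_integral Gamma (y + 1)) {0..}"
    using assms by (intro Gamma_integral_real) auto
qed (use assms in \<open>auto simp: exp_minus field_simps intro!: powr_mono2\<close>)

text \<open>Half of the exponential is set aside: t powr y * exp (-t/2) has its maximum exp (y ln (2
  y) - y) at t = 2 y, by ln u \<le> u - 1 with u = t / (2 y), and the other half integrates to 2.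
  The excess 2 powr y over Stirling is only exponential in y.\<close>

lemma Gamma_plus1_le:
  assumes "y > (0::real)"
  shows "Gamma (y + 1) \<le> 2 * exp (y * ln (2 * y) - y)"
proof (rule has_integral_le)
  show "((\<lambda>t. t powr (y + 1 - 1) / exp t) has_integral Gamma (y + 1)) {0..}"
    using assms by (intro Gamma_integral_real) auto
  have "((\<lambda>t. exp (y * ln (2 * y) - y) * exp (-(1/2) * t)) has_integral
          exp (y * ln (2 * y) - y) * (exp (-(1/2) * 0) / (1/2))) {0..}"
    using has_integral_exp_minus_to_infinity[of "1/2" 0] by (intro has_integral_mult_right) auto
  thus "((\<lambda>t. exp (y * ln (2 * y) - y) * exp (-(1/2) * t)) has_integral
          2 * exp (y * ln (2 * y) - y)) {0..}" by (simp add: mult.commute)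
  fix t :: real assume t: "t \<in> {0..}"
  show "t powr (y + 1 - 1) / exp t \<le> exp (y * ln (2 * y) - y) * exp (-(1/2) * t)"
  proof (cases "t = 0")
    case False
    with t have t: "t > 0" by simp
    have "ln (t / (2 * y)) \<le> t / (2 * y) - 1"
      using t assms by (intro ln_le_minus_one) auto
    hence "y * (ln t - ln (2 * y)) \<le> y * (t / (2 * y) - 1)"
      using t assms by (intro mult_left_mono) (auto simp: ln_div)
    hence "y * ln t - t \<le> y * ln (2 * y) - y + (-(1/2) * t)"
      using assms by (simp add: algebra_simps)
    hence "exp (y * ln t - t) \<le> exp (y * ln (2 * y) - y + (-(1/2) * t))"
      by simp
    thus ?thesis using t by (simp only: exp_add exp_diff powr_def) simp
  qed simp
qed

text \<open>The two Stirling bounds at y = a n + b - 1 share the leading term a n ln n; the shift b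
  and the excess factor 2 powr y affect only terms of order n.\<close>

lemma ln_Gamma_linear_bigo:
  fixes a b :: real
  assumes "a > 0"
  shows "(\<lambda>n. ln (Gamma (a * real n + b)) - a * real n * ln (real n)) \<in> O(real)"
proof -
  define y where "y = (\<lambda>n. a * real n + b - 1)"
  have "eventually (\<lambda>n. y n > 0) at_top"
    unfolding y_def using assms by real_asymp
  hence bounds: "eventually (\<lambda>n. y n * ln (y n) - y n \<le> ln (Gamma (a * real n + b)) \<and>
      ln (Gamma (a * real n + b)) \<le> ln 2 + y n * ln (2 * y n) - y n) at_top"
  proof eventually_elim
    case (elim n)
    have "ln (exp (y n * ln (y n) - y n)) \<le> ln (Gamma (y n + 1))"
      using elim Gamma_plus1_ge[of "y n"] by (intro ln_mono) auto
    moreover have "ln (Gamma (y n + 1)) \<le> ln (2 * exp (y n * ln (2 * y n) - y n))"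
      using elim Gamma_plus1_le[of "y n"] by (intro ln_mono) auto
    ultimately show ?case by (simp add: y_def ln_mult algebra_simps)
  qed
  have "(\<lambda>n. (y n * ln (y n) - y n) - a * real n * ln (real n)) \<in> O(real)"
    unfolding y_def using assms by real_asymp
  moreover have "(\<lambda>n. (ln 2 + y n * ln (2 * y n) - y n) - a * real n * ln (real n)) \<in> O(real)"
    unfolding y_def using assms by real_asymp
  \<comment> \<open>A quantity squeezed between two others is bounded in modulus by the sum of their
    moduli, whatever its sign.\<close>
  ultimately have *: "(\<lambda>n. \<bar>(y n * ln (y n) - y n) - a * real n * ln (real n)\<bar> + 
     \<bar>(ln 2 + y n * ln (2 * y n) - y n) - a * real n * ln (real n)\<bar>) \<in> O(real)"
    by (intro sum_in_bigo) auto
  have "eventually (\<lambda>n. norm (ln (Gamma (a * real n + b)) - a * real n * ln (real n)) \<le>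
     norm (\<bar>(y n * ln (y n) - y n) - a * real n * ln (real n)\<bar> + 
     \<bar>(ln 2 + y n * ln (2 * y n) - y n) - a * real n * ln (real n)\<bar>)) at_top"
    using bounds by eventually_elim auto
  from landau_o.big_trans[OF landau_o.big_mono[OF this] *] show ?thesis .
qed

section \<open>Growth along progressions and convergence of the coefficient series\<close>

lemma norm_Gamma_linear_le:
  fixes a :: real and \<beta> :: complex
  assumes "a > 0"
  shows "\<exists>K. eventually (\<lambda>n. norm (Gamma (of_real a * of_nat n + \<beta>))
           \<le> exp (K * real n + a * real n * ln (real n))) sequentially"
proof -
  obtain K where K: "eventually (\<lambda>n. \<bar>ln (Gamma (a * real n + Re \<beta>)) - a * real n * ln (real n)\<bar>
      \<le> K * real n) sequentially"
    using ln_Gamma_linear_bigo[OF assms, of "Re \<beta>"] by (elim landau_o.bigE) auto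
  have "eventually (\<lambda>n. a * real n + Re \<beta> > 0) sequentially"
    using assms by real_asymp
  with K have "eventually (\<lambda>n. norm (Gamma (of_real a * of_nat n + \<beta>))
           \<le> exp (K * real n + a * real n * ln (real n))) sequentially"
  proof eventually_elim
    case (elim n)
    have "norm (Gamma (of_real a * of_nat n + \<beta>)) \<le> Gamma (a * real n + Re \<beta>)"
      using norm_Gamma_le_Gamma_Re[of "of_real a * of_nat n + \<beta>"] elim by simp
    also have "\<dots> = exp (ln (Gamma (a * real n + Re \<beta>)))"
      using elim by simp
    also have "\<dots> \<le> exp (K * real n + a * real n * ln (real n))"
      using elim by (subst exp_le_cancel_iff) linarith
    finally show ?case .
  qed
  thus ?thesis ..
qed

text \<open>The theorem constrains only the sum of the Re \<alpha> j, so a single one may have any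
  sign. The real part of the argument tends to plus infinity, stays constant or tends to minus
  infinity, which decides between the right and left bounds. The imaginary part grows at most
  linearly, so exp (pi |Im|) is absorbed into exp (K n).\<close>

lemma norm_rGamma_linear_le:
  fixes \<alpha> \<beta> :: complex
  shows "\<exists>K. eventually (\<lambda>n. norm (rGamma (\<alpha> * of_nat n + \<beta>))
           \<le> exp (K * real n - Re \<alpha> * real n * ln (real n))) sequentially"
proof -
  define E where "E = pi * (\<bar>Im \<alpha>\<bar> + \<bar>Im \<beta>\<bar>)"
  have Im_le: "pi * \<bar>Im (\<alpha> * of_nat n + \<beta>)\<bar> \<le> E * real n" if "n \<ge> 1" for n
  proof -
    have "\<bar>Im (\<alpha> * of_nat n + \<beta>)\<bar> \<le> \<bar>Im \<alpha>\<bar> * real n + \<bar>Im \<beta>\<bar> * 1"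
      using abs_triangle_ineq[of "Im \<alpha> * real n" "Im \<beta>"] by (simp add: abs_mult)
    also have "\<dots> \<le> \<bar>Im \<alpha>\<bar> * real n + \<bar>Im \<beta>\<bar> * real n"
      using that by (intro add_left_mono mult_left_mono) auto
    finally have "pi * \<bar>Im (\<alpha> * of_nat n + \<beta>)\<bar> \<le> pi * (\<bar>Im \<alpha>\<bar> * real n + \<bar>Im \<beta>\<bar> * real n)"
      by (intro mult_left_mono) auto
    thus ?thesis by (simp add: E_def algebra_simps)
  qed
  consider "Re \<alpha> > 0" | "Re \<alpha> = 0" | "Re \<alpha> < 0" by linarith
  thus ?thesis
  proof cases
    case 1
    obtain K where K: "eventually (\<lambda>n. \<bar>ln (Gamma (Re \<alpha> * real n + Re \<beta>)) - Re \<alpha> * real n * ln (real n)\<bar>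
        \<le> K * real n) sequentially"
      using ln_Gamma_linear_bigo[OF 1, of "Re \<beta>"] by (elim landau_o.bigE) auto
    have "eventually (\<lambda>n. Re \<alpha> * real n + Re \<beta> \<ge> 1/2) sequentially"
      using 1 by real_asymp
    with K eventually_ge_at_top[of 1] have "eventually (\<lambda>n. norm (rGamma (\<alpha> * of_nat n + \<beta>))
           \<le> exp ((E + K) * real n - Re \<alpha> * real n * ln (real n))) sequentially"
    proof eventually_elim
      case (elim n)
      have "norm (rGamma (\<alpha> * of_nat n + \<beta>))
              \<le> exp (pi * \<bar>Im (\<alpha> * of_nat n + \<beta>)\<bar>) / Gamma (Re \<alpha> * real n + Re \<beta>)"
        using norm_rGamma_le_right[of "\<alpha> * of_nat n + \<beta>"] elim by simp
      also have "\<dots> = exp (pi * \<bar>Im (\<alpha> * of_nat n + \<beta>)\<bar> - ln (Gamma (Re \<alpha> * real n + Re \<beta>)))"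
        using elim by (simp add: exp_diff)
      also have "\<dots> \<le> exp ((E + K) * real n - Re \<alpha> * real n * ln (real n))"
        using elim Im_le[of n] by (subst exp_le_cancel_iff) (simp add: algebra_simps)
      finally show ?case .
    qed
    thus ?thesis ..
  next
    case 2
    \<comment> \<open>With Re \<alpha> = 0 the argument has real part Re \<beta> for every n, so one
      of the two bounds applies throughout and its Gamma factor is a constant.\<close>
    define C where "C = (if Re \<beta> \<ge> 1/2 then 1 / Gamma (Re \<beta>) else Gamma (1 - Re \<beta>) / pi)"
    have "C > 0" by (auto simp: C_def)
    have "eventually (\<lambda>n. norm (rGamma (\<alpha> * of_nat n + \<beta>))
           \<le> exp ((E + \<bar>ln C\<bar>) * real n - Re \<alpha> * real n * ln (real n))) sequentially"
      using eventually_ge_at_top[of 1]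
    proof eventually_elim
      case (elim n)
      have "norm (rGamma (\<alpha> * of_nat n + \<beta>)) \<le> exp (pi * \<bar>Im (\<alpha> * of_nat n + \<beta>)\<bar>) * C"
        using norm_rGamma_le_right[of "\<alpha> * of_nat n + \<beta>"] norm_rGamma_le_left[of "\<alpha> * of_nat n + \<beta>"] 2
        by (auto simp: C_def)
      also have "\<dots> = exp (pi * \<bar>Im (\<alpha> * of_nat n + \<beta>)\<bar> + ln C)"
        using \<open>C > 0\<close> by (simp add: exp_add)
      also have "pi * \<bar>Im (\<alpha> * of_nat n + \<beta>)\<bar> + ln C \<le> E * real n + \<bar>ln C\<bar> * 1"
        using Im_le[OF elim] by linarith
      also have "\<dots> \<le> E * real n + \<bar>ln C\<bar> * real n"
        using elim by (intro add_left_mono mult_left_mono) auto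
      finally show ?case using 2 by (simp add: algebra_simps)
    qed
    thus ?thesis ..
  next
    case 3
    obtain K where K: "eventually (\<lambda>n. \<bar>ln (Gamma (- Re \<alpha> * real n + (1 - Re \<beta>))) - - Re \<alpha> * real n * ln (real n)\<bar>
        \<le> K * real n) sequentially"
      using landau_o.bigE[OF ln_Gamma_linear_bigo[of "- Re \<alpha>" "1 - Re \<beta>"]] 3 by auto
    have "eventually (\<lambda>n. Re \<alpha> * real n + Re \<beta> \<le> 1/2) sequentially"
      using 3 by real_asymp
    with K eventually_ge_at_top[of 1] have "eventually (\<lambda>n. norm (rGamma (\<alpha> * of_nat n + \<beta>))
           \<le> exp ((E + K) * real n - Re \<alpha> * real n * ln (real n))) sequentially"
    proof eventually_elim
      case (elim n)
      define g where "g = Gamma (- Re \<alpha> * real n + (1 - Re \<beta>))"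
      have g: "g > 0" unfolding g_def using elim by (intro Gamma_real_pos) auto
      have "norm (rGamma (\<alpha> * of_nat n + \<beta>)) \<le> exp (pi * \<bar>Im (\<alpha> * of_nat n + \<beta>)\<bar>) * g / pi"
        using norm_rGamma_le_left[of "\<alpha> * of_nat n + \<beta>"] elim by (simp add: g_def algebra_simps)
      also have "\<dots> \<le> exp (pi * \<bar>Im (\<alpha> * of_nat n + \<beta>)\<bar>) * g / 1"
        using g pi_gt3 by (intro divide_left_mono) auto
      also have "\<dots> = exp (pi * \<bar>Im (\<alpha> * of_nat n + \<beta>)\<bar> + ln g)"
        using g by (simp add: exp_add)
      also have "\<dots> \<le> exp ((E + K) * real n - Re \<alpha> * real n * ln (real n))"
        using elim Im_le[of n] by (subst exp_le_cancel_iff) (simp add: g_def algebra_simps)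
      finally show ?case .
    qed
    thus ?thesis ..
  qed
qed

lemma norm_prod_rGamma_linear_le:
  fixes \<alpha> \<beta> :: "'a \<Rightarrow> complex"
  assumes "finite J"
  shows "\<exists>K. eventually (\<lambda>n. norm (\<Prod>j\<in>J. rGamma (\<alpha> j * of_nat n + \<beta> j))
           \<le> exp (K * real n - (\<Sum>j\<in>J. Re (\<alpha> j)) * real n * ln (real n))) sequentially"
  using assms
proof (induction J)
  case empty
  have "eventually (\<lambda>n. norm (\<Prod>j\<in>{}. rGamma (\<alpha> j * of_nat n + \<beta> j))
           \<le> exp (0 * real n - (\<Sum>j\<in>{}. Re (\<alpha> j)) * real n * ln (real n))) sequentially"
    by simp
  thus ?case ..
next
  case (insert i J)
  obtain K L where
    "eventually (\<lambda>n. norm (\<Prod>j\<in>J. rGamma (\<alpha> j * of_nat n + \<beta> j))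
           \<le> exp (K * real n - (\<Sum>j\<in>J. Re (\<alpha> j)) * real n * ln (real n))) sequentially"
    "eventually (\<lambda>n. norm (rGamma (\<alpha> i * of_nat n + \<beta> i))
           \<le> exp (L * real n - Re (\<alpha> i) * real n * ln (real n))) sequentially"
    using insert.IH norm_rGamma_linear_le by blast
  hence "eventually (\<lambda>n. norm (\<Prod>j\<in>insert i J. rGamma (\<alpha> j * of_nat n + \<beta> j))
           \<le> exp ((K + L) * real n - (\<Sum>j\<in>insert i J. Re (\<alpha> j)) * real n * ln (real n))) sequentially"
  proof eventually_elim
    case (elim n)
    have "norm (\<Prod>j\<in>insert i J. rGamma (\<alpha> j * of_nat n + \<beta> j)) =
      norm (rGamma (\<alpha> i * of_nat n + \<beta> i)) * norm (\<Prod>j\<in>J. rGamma (\<alpha> j * of_nat n + \<beta> j))"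
      using insert.hyps by (simp add: norm_mult)
    also have "\<dots> \<le> exp (L * real n - Re (\<alpha> i) * real n * ln (real n)) *
        exp (K * real n - (\<Sum>j\<in>J. Re (\<alpha> j)) * real n * ln (real n))"
      using elim by (intro mult_mono) auto
    also have "\<dots> = exp ((K + L) * real n - (\<Sum>j\<in>insert i J. Re (\<alpha> j)) * real n * ln (real n))"
      using insert.hyps by (simp flip: exp_add add: algebra_simps)
    finally show ?case .
  qed
  thus ?case ..
qed

text \<open>The factorial is treated as one more factor \<open>rGamma\<close> at n + 1, which
  supplies the 1 in the decay rate S + 1 - \<kappa>. As this rate is positive, n ln n dominates
  every linear term in the exponent, including the one from z ^ n, and a geometric series of ratio
  exp (-1) is a majorant.\<close>

lemma summable_Gamma_quotient_power_series:
  fixes \<alpha> \<beta> :: "'a \<Rightarrow> complex" and \<gamma> z :: complex and \<kappa> :: real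
  assumes "finite J" "\<kappa> > 0" "(\<Sum>j\<in>J. Re (\<alpha> j)) > \<kappa> - 1"
  shows "summable (\<lambda>n. norm (Gamma (of_real \<kappa> * of_nat n + \<gamma>) *
           (\<Prod>j\<in>J. rGamma (\<alpha> j * of_nat n + \<beta> j)) / fact n * z ^ n))"
proof -
  define S where "S = (\<Sum>j\<in>J. Re (\<alpha> j))"
  have S: "S + 1 - \<kappa> > 0" using assms by (simp add: S_def)
  obtain K1 K2 K3 where
    "eventually (\<lambda>n. norm (Gamma (of_real \<kappa> * of_nat n + \<gamma>))
           \<le> exp (K1 * real n + \<kappa> * real n * ln (real n))) sequentially"
    "eventually (\<lambda>n. norm (\<Prod>j\<in>J. rGamma (\<alpha> j * of_nat n + \<beta> j))
           \<le> exp (K2 * real n - S * real n * ln (real n))) sequentially"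
    "eventually (\<lambda>n. norm (rGamma (1 * of_nat n + 1 :: complex))
           \<le> exp (K3 * real n - Re 1 * real n * ln (real n))) sequentially"
    unfolding S_def using norm_Gamma_linear_le[OF assms(2)] norm_prod_rGamma_linear_le[OF assms(1)]
      norm_rGamma_linear_le by meson
  moreover have "eventually (\<lambda>n. (K1 + K2 + K3 + norm z) * real n - (S + 1 - \<kappa>) * real n * ln (real n)
                   \<le> - real n) sequentially"
    using S by real_asymp
  ultimately have "eventually (\<lambda>n. norm (Gamma (of_real \<kappa> * of_nat n + \<gamma>) *
       (\<Prod>j\<in>J. rGamma (\<alpha> j * of_nat n + \<beta> j)) / fact n * z ^ n) \<le> exp (-1) ^ n) sequentially"
  proof eventually_elim
    case (elim n)
    \<comment> \<open>Using norm z \<le> exp (norm z) instead of a logarithm of norm z includes the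
      case z = 0.\<close>
    have z: "norm z ^ n \<le> exp (norm z * real n)"
    proof -
      have "norm z \<le> exp (norm z)" using exp_ge_add_one_self[of "norm z"] by linarith
      hence "norm z ^ n \<le> exp (norm z) ^ n" by (intro power_mono) auto
      thus ?thesis by (simp flip: exp_of_nat_mult add: mult.commute)
    qed
    have fact: "norm (1 / fact n :: complex) \<le> exp (K3 * real n - real n * ln (real n))"
      using elim(3) Gamma_fact[of n, where 'a = complex]
      by (simp add: rGamma_inverse_Gamma add.commute inverse_eq_divide)
    have "norm (Gamma (of_real \<kappa> * of_nat n + \<gamma>) * (\<Prod>j\<in>J. rGamma (\<alpha> j * of_nat n + \<beta> j)) / fact n * z ^ n)
        = norm (Gamma (of_real \<kappa> * of_nat n + \<gamma>)) * norm (\<Prod>j\<in>J. rGamma (\<alpha> j * of_nat n + \<beta> j))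
           * norm (1 / fact n :: complex) * norm z ^ n"
      by (simp add: norm_mult norm_divide norm_power)
    also have "\<dots> \<le> exp (K1 * real n + \<kappa> * real n * ln (real n)) * exp (K2 * real n - S * real n * ln (real n))
        * exp (K3 * real n - real n * ln (real n)) * exp (norm z * real n)"
      using elim fact z by (intro mult_mono mult_nonneg_nonneg) auto
    also have "\<dots> = exp ((K1 + K2 + K3 + norm z) * real n - (S + 1 - \<kappa>) * real n * ln (real n))"
      by (simp flip: exp_add add: algebra_simps)
    also have "\<dots> \<le> exp (- real n)"
      using elim by simp
    also have "\<dots> = exp (-1) ^ n"
      by (simp flip: exp_of_nat_mult)
    finally show ?case .
  qed
  hence "eventually (\<lambda>n. norm (norm (Gamma (of_real \<kappa> * of_nat n + \<gamma>) *
       (\<Prod>j\<in>J. rGamma (\<alpha> j * of_nat n + \<beta> j)) / fact n * z ^ n)) \<le> exp (-1) ^ n) sequentially"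
    by simp
  thus ?thesis
    by (rule summable_comparison_test_ev) (simp add: summable_geometric)
qed

subsection \<open>The complex Beta integral on a half-line\<close>

lemma measurable_of_real_powr [measurable]:
  assumes [measurable]: "f \<in> borel_measurable M"
  shows "(\<lambda>t. of_real (f t) powr z :: complex) \<in> borel_measurable M"
proof -
  have "of_real t powr z = (if t = 0 then 0 else if t > 0 then exp (z * of_real (ln t))
          else exp (z * (of_real (ln (- t)) + \<i> * of_real pi)))" for t :: real
    using Ln_minus[of "of_real (- t)"] Ln_of_real[of "- t"] by (auto simp: powr_def Ln_of_real)
  hence "(\<lambda>t. of_real t powr z :: complex) = (\<lambda>t. if t = 0 then 0 else if t > 0 then exp (z * of_real (ln t))
          else exp (z * (of_real (ln (- t)) + \<i> * of_real pi)))" by blast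
  hence "(\<lambda>t. of_real t powr z :: complex) \<in> borel_measurable borel"
    by simp
  thus ?thesis by measurable
qed

text \<open>Euler's integral after the scaling of u by v. The Bochner form is the one that Fubini's
  theorem needs below.\<close>

lemma has_bochner_integral_Gamma:
  assumes "Re z > 0" "v > 0"
  shows "has_bochner_integral lborel
           (\<lambda>u. indicator {0<..} u *\<^sub>R (of_real u powr (z - 1) * of_real (exp (- (v * u)))))
           (Gamma z * of_real v powr (- z))"
proof -
  define f where "f = (\<lambda>u. indicator {0<..} u *\<^sub>R (of_real u powr (z - 1) / of_real (exp u)) :: complex)"
  have [measurable]: "f \<in> borel_measurable borel"
    unfolding f_def by measurable
  have "integrable lebesgue f"
    using absolutely_integrable_Gamma_integral'[OF assms(1)] by (simp add: set_integrable_def f_def)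
  hence int: "integrable lborel f"
    by (simp add: integrable_completion)
  have "(f has_integral Gamma z) UNIV"
    using Gamma_integral_complex'[OF assms(1)]
    by (subst (asm) has_integral_restrict_UNIV [symmetric])
       (simp add: f_def indicator_def of_bool_def if_distrib if_distribR cong: if_cong)
  hence "integral\<^sup>L lborel f = Gamma z"
    using has_integral_integral_lborel[OF int] has_integral_unique by blast
  with int have "has_bochner_integral lborel f (Gamma z)"
    by (simp add: has_bochner_integral_iff)
  hence "has_bochner_integral lborel (\<lambda>u. f (0 + v * u)) (Gamma z /\<^sub>R \<bar>v\<bar>)"
    using assms by (subst (asm) lborel_has_bochner_integral_real_affine_iff[of v _ _ 0]) auto
  \<comment> \<open>This factor cancels the power of v in (v u) powr (z - 1); together with the
    Jacobian 1 / v it yields v powr (-z).\<close>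
  hence "has_bochner_integral lborel (\<lambda>u. of_real v powr (1 - z) * f (0 + v * u))
           (of_real v powr (1 - z) * (Gamma z /\<^sub>R \<bar>v\<bar>))"
    by (intro has_bochner_integral_mult_right) auto
  also have "(\<lambda>u. of_real v powr (1 - z) * f (0 + v * u)) =
     (\<lambda>u. indicator {0<..} u *\<^sub>R (of_real u powr (z - 1) * of_real (exp (- (v * u)))))"
  proof
    fix u :: real
    show "of_real v powr (1 - z) * f (0 + v * u) =
      indicator {0<..} u *\<^sub>R (of_real u powr (z - 1) * of_real (exp (- (v * u))))"
    proof (cases "u > 0")
      case True
      have "of_real v powr (1 - z) * of_real (v * u) powr (z - 1) = of_real u powr (z - 1)"
        using True assms powr_add[of "of_real v" "1 - z" "z - 1"]
        by (simp add: powr_times_real mult.assoc [symmetric])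
      with True assms show ?thesis
        by (simp add: f_def exp_minus field_simps)
    qed (use assms in \<open>auto simp: f_def zero_less_mult_iff\<close>)
  qed
  also have "of_real v powr (1 - z) * (Gamma z /\<^sub>R \<bar>v\<bar>) = Gamma z * of_real v powr (- z)"
    using assms powr_diff[of "of_real v" "1 - z" 1] by (simp add: scaleR_conv_of_real field_simps)
  finally show ?thesis .
qed

lemma has_bochner_integral_shifted_Beta:
  fixes s \<mu> :: complex and x :: real
  assumes "Re \<mu> > 0" "Re s > Re \<mu>" "x > 0"
  shows "has_bochner_integral lborel
           (\<lambda>u. indicator {0<..} u *\<^sub>R (of_real (x + u) powr (- s) * of_real u powr (\<mu> - 1)))
           (Gamma \<mu> * Gamma (s - \<mu>) / Gamma s * of_real x powr (\<mu> - s))"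
proof -
  \<comment> \<open>Integrating F over v first gives the integrand times Gamma s; integrating over u first
      leaves a Gamma integral in v.\<close>
  define F :: "complex \<Rightarrow> complex \<Rightarrow> real \<Rightarrow> real \<Rightarrow> complex" where
    "F = (\<lambda>s \<mu> v u. indicator {0<..} v *\<^sub>R indicator {0<..} u *\<^sub>R
            (of_real v powr (s - 1) * of_real u powr (\<mu> - 1) * of_real (exp (- (v * (x + u))))))"
  define G :: "complex \<Rightarrow> complex \<Rightarrow> real \<Rightarrow> complex" where
    "G = (\<lambda>s \<mu> v. Gamma \<mu> * (indicator {0<..} v *\<^sub>R (of_real v powr (s - \<mu> - 1) * of_real (exp (- (x * v))))))"
  have inner_u: "has_bochner_integral lborel (F s \<mu> v) (G s \<mu> v)" if "Re \<mu> > 0" for s \<mu> v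
  proof (cases "v > 0")
    case True
    have "has_bochner_integral lborel
        (\<lambda>u. of_real v powr (s - 1) * of_real (exp (- (v * x))) *
            (indicator {0<..} u *\<^sub>R (of_real u powr (\<mu> - 1) * of_real (exp (- (v * u))))))
        (of_real v powr (s - 1) * of_real (exp (- (v * x))) * (Gamma \<mu> * of_real v powr (- \<mu>)))"
      using True that by (intro has_bochner_integral_mult_right has_bochner_integral_Gamma) auto
    also have "of_real v powr (s - 1) * of_real (exp (- (v * x))) * (Gamma \<mu> * of_real v powr (- \<mu>)) = G s \<mu> v"
      using True powr_add[of "of_real v" "s - 1" "- \<mu>"] by (simp add: G_def algebra_simps)
    also have "(\<lambda>u. of_real v powr (s - 1) * of_real (exp (- (v * x))) *
            (indicator {0<..} u *\<^sub>R (of_real u powr (\<mu> - 1) * of_real (exp (- (v * u)))))) = F s \<mu> v"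
      using True by (auto simp: F_def fun_eq_iff indicator_def ring_distribs exp_add exp_diff exp_minus field_simps)
    finally show ?thesis .
  qed (auto simp: F_def G_def)
  have G_integral: "has_bochner_integral lborel (G s \<mu>) (Gamma \<mu> * (Gamma (s - \<mu>) * of_real x powr (\<mu> - s)))"
    if "Re s > Re \<mu>" for s \<mu>
    unfolding G_def using has_bochner_integral_Gamma[of "s - \<mu>" x] that \<open>x > 0\<close>
    by (intro has_bochner_integral_mult_right) auto
  \<comment> \<open>Taking norms merely replaces s and \<mu> by their real parts, so absolute
    integrability comes from the same two integrals at real parameters. For this reason
    \<open>F\<close> and \<open>G\<close> take s and \<mu> as arguments.\<close>
  have norm_F: "of_real (norm (F s \<mu> v u)) = F (of_real (Re s)) (of_real (Re \<mu>)) v u" for s \<mu> v u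
    by (cases "u > 0"; cases "v > 0")
       (auto simp: F_def norm_mult norm_powr_real_powr powr_of_real [symmetric])
  have [measurable]: "case_prod (F s \<mu>) \<in> borel_measurable (lborel \<Otimes>\<^sub>M lborel)"
    unfolding F_def by measurable
  have F_integrable: "integrable (lborel \<Otimes>\<^sub>M lborel) (case_prod (F s \<mu>))"
  proof (rule lborel_pair.Fubini_integrable)
    have "of_real (\<integral>u. norm (F s \<mu> v u) \<partial>lborel) = G (of_real (Re s)) (of_real (Re \<mu>)) v" for v
    proof -
      have "of_real (\<integral>u. norm (F s \<mu> v u) \<partial>lborel) = (\<integral>u. of_real (norm (F s \<mu> v u)) \<partial>lborel :: complex)"
        by simp
      also have "\<dots> = G (of_real (Re s)) (of_real (Re \<mu>)) v"
        unfolding norm_F using inner_u assms by (intro has_bochner_integral_integral_eq) auto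
      finally show ?thesis .
    qed
    hence "integrable lborel (\<lambda>v. of_real (\<integral>u. norm (F s \<mu> v u) \<partial>lborel) :: complex)"
      using G_integral[of "of_real (Re \<mu>)" "of_real (Re s)"] assms by (simp add: has_bochner_integral_iff)
    thus "integrable lborel (\<lambda>v. \<integral>u. norm (case_prod (F s \<mu>) (v, u)) \<partial>lborel)"
      unfolding complex_of_real_integrable_eq by simp
    show "AE v in lborel. integrable lborel (\<lambda>u. case_prod (F s \<mu>) (v, u))"
      using inner_u assms by (auto simp: has_bochner_integral_iff)
  qed auto
  have inner_v: "(\<integral>v. F s \<mu> v u \<partial>lborel) =
      Gamma s * (indicator {0<..} u *\<^sub>R (of_real (x + u) powr (- s) * of_real u powr (\<mu> - 1)))" for u
  proof (cases "u > 0")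
    case True
    have "has_bochner_integral lborel
        (\<lambda>v. of_real u powr (\<mu> - 1) * (indicator {0<..} v *\<^sub>R (of_real v powr (s - 1) * of_real (exp (- ((x + u) * v))))))
        (of_real u powr (\<mu> - 1) * (Gamma s * of_real (x + u) powr (- s)))"
      using True assms by (intro has_bochner_integral_mult_right has_bochner_integral_Gamma) auto
    also have "(\<lambda>v. of_real u powr (\<mu> - 1) * (indicator {0<..} v *\<^sub>R (of_real v powr (s - 1) * of_real (exp (- ((x + u) * v))))))
        = (\<lambda>v. F s \<mu> v u)"
      using True by (auto simp: F_def fun_eq_iff indicator_def mult_ac)
    finally show ?thesis
      using True by (simp add: has_bochner_integral_iff mult_ac)
  qed (auto simp: F_def)
  have "Gamma s \<noteq> 0"
    using assms by (auto simp: Gamma_eq_zero_iff elim!: nonpos_Ints_cases)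
  have "integrable lborel (\<lambda>u. inverse (Gamma s) * (\<integral>v. F s \<mu> v u \<partial>lborel))"
    by (intro integrable_mult_right lborel_pair.integrable_snd F_integrable)
  moreover have "(\<integral>u. inverse (Gamma s) * (\<integral>v. F s \<mu> v u \<partial>lborel) \<partial>lborel) =
      Gamma \<mu> * Gamma (s - \<mu>) / Gamma s * of_real x powr (\<mu> - s)"
  proof -
    have "(\<integral>u. (\<integral>v. F s \<mu> v u \<partial>lborel) \<partial>lborel) = (\<integral>v. (\<integral>u. F s \<mu> v u \<partial>lborel) \<partial>lborel)"
      by (rule lborel_pair.Fubini_integral) (rule F_integrable)
    also have "\<dots> = (\<integral>v. G s \<mu> v \<partial>lborel)"
      using inner_u assms by (simp add: has_bochner_integral_iff)
    also have "\<dots> = Gamma \<mu> * (Gamma (s - \<mu>) * of_real x powr (\<mu> - s))"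
      using G_integral assms by (simp add: has_bochner_integral_iff)
    finally show ?thesis by (simp add: field_simps)
  qed
  moreover have "inverse (Gamma s) * (\<integral>v. F s \<mu> v u \<partial>lborel) =
      indicator {0<..} u *\<^sub>R (of_real (x + u) powr (- s) * of_real u powr (\<mu> - 1))" for u
    unfolding inner_v using \<open>Gamma s \<noteq> 0\<close> by (simp add: field_simps)
  ultimately show ?thesis
    unfolding has_bochner_integral_iff by simp
qed

subsection \<open>Fractional integration and differentiation of power series in $1/x$\<close>

text \<open>The Beta integral under the shift u = t - x. Up to 1 / Gamma \<mu> it is the fractional
  integral of a single power.\<close>

lemma has_bochner_integral_RL_kernel_powr:
  fixes s \<mu> :: complex and x :: real
  assumes "Re \<mu> > 0" "Re s > Re \<mu>" "x > 0"
  shows "has_bochner_integral lborel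
           (\<lambda>t. indicator {x<..} t *\<^sub>R (of_real t powr (- s) / of_real (t - x) powr (1 - \<mu>)))
           (Gamma \<mu> * Gamma (s - \<mu>) / Gamma s * of_real x powr (\<mu> - s))"
proof -
  have "has_bochner_integral lborel
      (\<lambda>t. indicator {0<..} (- x + 1 * t) *\<^sub>R
         (of_real (x + (- x + 1 * t)) powr (- s) * of_real (- x + 1 * t) powr (\<mu> - 1)))
      ((Gamma \<mu> * Gamma (s - \<mu>) / Gamma s * of_real x powr (\<mu> - s)) /\<^sub>R \<bar>1\<bar>)"
    by (subst lborel_has_bochner_integral_real_affine_iff [symmetric])
       (use has_bochner_integral_shifted_Beta[OF assms] in auto)
  also have "(\<lambda>t. indicator {0<..} (- x + 1 * t) *\<^sub>R
         (of_real (x + (- x + 1 * t)) powr (- s) * of_real (- x + 1 * t) powr (\<mu> - 1))) =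
      (\<lambda>t. indicator {x<..} t *\<^sub>R (of_real t powr (- s) / of_real (t - x) powr (1 - \<mu>)))"
    by (auto simp: fun_eq_iff indicator_def powr_minus_divide [of _ "1 - \<mu>", simplified])
  finally show ?thesis by simp
qed

lemma powr_minus_add_of_nat:
  "t > 0 \<Longrightarrow> of_real t powr (- (s + of_nat n)) = of_real t powr (- s) * (1 / of_real t :: complex) ^ n"
  using powr_diff[of "of_real t" "- s" "of_nat n"] by (simp add: powr_nat' power_divide)

text \<open>Every term is the fixed integrable kernel \<open>k\<close> times a n / t ^ n, and for t
  > x the latter is at most norm (a n) / x ^ n; this majorant permits exchanging sum and integral.
  Dividing by x powr (\<mu> - \<delta>) leaves a plain power series in 1 / x, and the
  \<open>sums\<close> form also records its convergence, which is needed before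
  differentiating.\<close>

lemma RL_integral_right_power_series:
  fixes a :: "nat \<Rightarrow> complex" and \<mu> \<delta> :: complex and x :: real
  assumes a: "\<And>z. summable (\<lambda>n. norm (a n * z ^ n))"
    and "Re \<mu> > 0" "Re \<delta> > Re \<mu>" "x > 0"
  defines "f \<equiv> (\<lambda>t. of_real t powr (- \<delta>) * (\<Sum>n. a n * (1 / of_real t) ^ n))"
  defines "b \<equiv> (\<lambda>n. a n * Gamma (\<delta> - \<mu> + of_nat n) / Gamma (\<delta> + of_nat n))"
  shows "(\<lambda>n. b n * (1 / of_real x) ^ n) sums (RL_integral_right \<mu> f x / of_real x powr (\<mu> - \<delta>))"
proof -
  define h :: "nat \<Rightarrow> real \<Rightarrow> complex" where
    "h = (\<lambda>n t. a n * (indicator {x<..} t *\<^sub>R (of_real t powr (- (\<delta> + of_nat n)) / of_real (t - x) powr (1 - \<mu>))))"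
  define k :: "real \<Rightarrow> complex" where
    "k = (\<lambda>t. indicator {x<..} t *\<^sub>R (of_real t powr (- \<delta>) / of_real (t - x) powr (1 - \<mu>)))"
  have k: "integrable lborel k"
    unfolding k_def using has_bochner_integral_RL_kernel_powr[of \<mu> \<delta> x] assms by (simp add: has_bochner_integral_iff)
  have h_integral: "has_bochner_integral lborel (h n)
     (a n * (Gamma \<mu> * Gamma (\<delta> + of_nat n - \<mu>) / Gamma (\<delta> + of_nat n) * of_real x powr (\<mu> - (\<delta> + of_nat n))))" for n
    unfolding h_def using assms
    by (intro has_bochner_integral_mult_right has_bochner_integral_RL_kernel_powr) auto
  have h_eq: "h n t = k t * (a n * (1 / of_real t) ^ n)" for n t
  proof (cases "t > x")
    case True
    with \<open>x > 0\<close> show ?thesis using powr_minus_add_of_nat[of t \<delta> n]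
      by (simp add: h_def k_def)
  qed (auto simp: h_def k_def)
  have h_le: "norm (h n t) \<le> norm (a n * (1 / of_real x) ^ n) * norm (k t)" for n t
  proof (cases "t > x")
    case True
    have "(1 / t) ^ n \<le> (1 / x) ^ n"
      using True \<open>x > 0\<close> by (intro power_mono divide_left_mono) auto
    hence "norm (a n * (1 / of_real t) ^ n) \<le> norm (a n * (1 / of_real x) ^ n)"
      using True \<open>x > 0\<close> by (simp add: norm_mult norm_power norm_divide mult_left_mono)
    thus ?thesis
      unfolding h_eq norm_mult[of "k t"] by (simp add: mult.commute mult_left_mono)
  qed (auto simp: h_eq k_def)
  have "(\<lambda>n. integral\<^sup>L lborel (h n)) sums (\<integral>t. (\<Sum>n. h n t) \<partial>lborel)"
  proof (rule sums_integral)
    show "integrable lborel (h n)" for n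
      using h_integral by (simp add: has_bochner_integral_iff)
    show "AE t in lborel. summable (\<lambda>n. norm (h n t))"
      unfolding h_eq norm_mult[of "k _"] by (intro AE_I2 summable_mult a)
    show "summable (\<lambda>n. \<integral>t. norm (h n t) \<partial>lborel)"
    proof (rule summable_comparison_test)
      show "summable (\<lambda>n. norm (a n * (1 / of_real x) ^ n) * (\<integral>t. norm (k t) \<partial>lborel))"
        by (intro summable_mult2 a)
      have "(\<integral>t. norm (h n t) \<partial>lborel) \<le> (\<integral>t. norm (a n * (1 / of_real x) ^ n) * norm (k t) \<partial>lborel)" for n
        using h_integral k h_le by (intro integral_mono) (auto simp: has_bochner_integral_iff)
      thus "\<exists>N. \<forall>n\<ge>N. norm (\<integral>t. norm (h n t) \<partial>lborel) \<le> norm (a n * (1 / of_real x) ^ n) * (\<integral>t. norm (k t) \<partial>lborel)"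
        by simp
    qed
  qed
  also have "(\<integral>t. (\<Sum>n. h n t) \<partial>lborel) = (LBINT t:{x<..}. f t / of_real (t - x) powr (1 - \<mu>))"
    unfolding set_lebesgue_integral_def
  proof (rule Bochner_Integration.integral_cong)
    fix t :: real
    show "(\<Sum>n. h n t) = indicator {x<..} t *\<^sub>R (f t / of_real (t - x) powr (1 - \<mu>))"
      unfolding h_eq suminf_mult[OF summable_norm_cancel[OF a]] by (simp add: k_def f_def)
  qed auto
  also have "(\<lambda>n. integral\<^sup>L lborel (h n)) = (\<lambda>n. Gamma \<mu> * of_real x powr (\<mu> - \<delta>) * (b n * (1 / of_real x) ^ n))"
  proof
    fix n
    have "of_real x powr (\<mu> - (\<delta> + of_nat n)) = of_real x powr (\<mu> - \<delta>) * (1 / of_real x) ^ n"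
      using powr_minus_add_of_nat[OF \<open>x > 0\<close>, of "\<delta> - \<mu>" n] by (simp add: algebra_simps)
    thus "integral\<^sup>L lborel (h n) = Gamma \<mu> * of_real x powr (\<mu> - \<delta>) * (b n * (1 / of_real x) ^ n)"
      using h_integral[of n] by (simp add: has_bochner_integral_iff b_def algebra_simps)
  qed
  finally have sums: "(\<lambda>n. Gamma \<mu> * of_real x powr (\<mu> - \<delta>) * (b n * (1 / of_real x) ^ n)) sums
      (LBINT t:{x<..}. f t / of_real (t - x) powr (1 - \<mu>))" .
  have "Gamma \<mu> \<noteq> 0"
    using assms by (auto simp: Gamma_eq_zero_iff elim!: nonpos_Ints_cases)
  thus ?thesis
    using sums_divide[OF sums, of "Gamma \<mu> * of_real x powr (\<mu> - \<delta>)"] \<open>x > 0\<close>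
    by (simp add: RL_integral_right_def mult.commute)
qed

section \<open>Term-by-term differentiation\<close>

text \<open>Multiplying the n-th coefficient by s + n is the action of the Euler operator s + z
  d/dz. Summability of the new series comes with its value.\<close>

lemma sums_add_of_nat_times_power_series:
  fixes b :: "nat \<Rightarrow> complex"
  assumes b: "\<And>z. summable (\<lambda>n. b n * z ^ n)"
  shows "(\<lambda>n. (s + of_nat n) * b n * z ^ n) sums
           (s * (\<Sum>n. b n * z ^ n) + z * (\<Sum>n. diffs b n * z ^ n))"
proof -
  have "summable (\<lambda>n. diffs b n * z ^ n)"
    by (rule termdiff_converges_all) (rule b)
  hence "(\<lambda>n. z * (of_nat n * b n * z ^ (n - Suc 0))) sums (z * (\<Sum>n. diffs b n * z ^ n))"
    by (intro sums_mult diffs_equiv)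
  moreover have "(\<lambda>n. z * (of_nat n * b n * z ^ (n - Suc 0))) = (\<lambda>n. of_nat n * b n * z ^ n)"
  proof
    fix n show "z * (of_nat n * b n * z ^ (n - Suc 0)) = of_nat n * b n * z ^ n"
      by (cases n) auto
  qed
  ultimately have "(\<lambda>n. s * (b n * z ^ n) + of_nat n * b n * z ^ n) sums
      (s * (\<Sum>n. b n * z ^ n) + z * (\<Sum>n. diffs b n * z ^ n))"
    by (intro sums_add sums_mult summable_sums b) simp
  thus ?thesis by (simp add: algebra_simps)
qed

text \<open>By the chain rule -d/dx turns x powr (-s) B(1/x) into x powr (-s-1) (s B(1/x) + (1/x)
  B'(1/x)), and the bracket is the Euler operator at z = 1/x. The derivative is taken in the complex
  plane, off the branch cut, and then restricted to the real line.\<close>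

lemma has_vector_derivative_power_series_inverse:
  fixes b :: "nat \<Rightarrow> complex" and s :: complex and x :: real
  assumes b: "\<And>z. summable (\<lambda>n. b n * z ^ n)" and "x > 0"
  shows "((\<lambda>x. of_real x powr (- s) * (\<Sum>n. b n * (1 / of_real x) ^ n)) has_vector_derivative
           - (of_real x powr (- (s + 1)) * (\<Sum>n. (s + of_nat n) * b n * (1 / of_real x) ^ n))) (at x)"
proof -
  define B where "B = (\<lambda>z. \<Sum>n. b n * z ^ n)"
  define B' where "B' = (\<lambda>z. \<Sum>n. diffs b n * z ^ n)"
  have B: "(B has_field_derivative B' z) (at z)" for z
    unfolding B_def B'_def by (rule termdiffs_strong_converges_everywhere) (rule b)
  have "((\<lambda>w. w powr (- s) * B (1 / w)) has_field_derivative
          - (of_real x powr (- (s + 1)) * (s * B (1 / of_real x) + (1 / of_real x) * B' (1 / of_real x))))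
          (at (of_real x))"
  proof -
    have s1: "- (s + 1) = - s - 1" by simp
    have "of_real x powr (- s) = of_real x * of_real x powr (- s - 1)"
      using powr_add[of "of_real x" 1 "- s - 1"] \<open>x > 0\<close> by simp
    moreover have "((\<lambda>w. w powr (- s) * B (1 / w)) has_field_derivative
       (of_real x powr (- s) * (B' (1 / of_real x) * (- 1 / of_real x ^ 2)) +
        (- s * of_real x powr (- s - 1)) * B (1 / of_real x))) (at (of_real x))"
      by (rule derivative_eq_intros DERIV_chain2[OF B] refl | (use \<open>x > 0\<close> in \<open>force simp: power2_eq_square complex_nonpos_Reals_iff\<close>))+
    ultimately show ?thesis
      unfolding s1 using \<open>x > 0\<close> by (elim DERIV_cong) (simp add: field_simps power2_eq_square)
  qed
  hence "((\<lambda>x. of_real x powr (- s) * B (1 / of_real x)) has_vector_derivative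
          - (of_real x powr (- (s + 1)) * (s * B (1 / of_real x) + (1 / of_real x) * B' (1 / of_real x)))) (at x)"
    by (rule has_vector_derivative_real_field)
  thus "((\<lambda>x. of_real x powr (- s) * (\<Sum>n. b n * (1 / of_real x) ^ n)) has_vector_derivative
           - (of_real x powr (- (s + 1)) * (\<Sum>n. (s + of_nat n) * b n * (1 / of_real x) ^ n))) (at x)"
    using sums_add_of_nat_times_power_series[OF b, of s "1 / of_real x"]
    by (simp add: B_def B'_def sums_iff)
qed

text \<open>Each differentiation raises s by one, so the factors s + n, s + 1 + n, ... accumulate to
  a Pochhammer symbol. Summability everywhere is carried through the induction because the next
  differentiation requires it.\<close>

lemma iterated_neg_vector_derivative_power_series:
  fixes b :: "nat \<Rightarrow> complex" and s :: complex
  assumes b: "\<And>z. summable (\<lambda>n. b n * z ^ n)"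
    and f: "\<And>x. x > 0 \<Longrightarrow> f x = of_real x powr (- s) * (\<Sum>n. b n * (1 / of_real x) ^ n)"
  defines "c \<equiv> (\<lambda>k n. pochhammer (s + of_nat n) k * b n)"
  shows "(\<forall>z. summable (\<lambda>n. c k n * z ^ n)) \<and>
         (\<forall>x>0. ((\<lambda>g x. - vector_derivative g (at x)) ^^ k) f x
            = of_real x powr (- (s + of_nat k)) * (\<Sum>n. c k n * (1 / of_real x) ^ n))"
proof (induction k)
  case 0
  show ?case using b f by (simp add: c_def)
next
  case (Suc k)
  let ?g = "((\<lambda>g x. - vector_derivative g (at x)) ^^ k) f"
  have c_Suc: "c (Suc k) = (\<lambda>n. (s + of_nat k + of_nat n) * c k n)"
    by (simp add: c_def fun_eq_iff pochhammer_Suc algebra_simps)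
  have IH: "summable (\<lambda>n. c k n * z ^ n)" for z using Suc.IH by blast
  have "- vector_derivative ?g (at x) =
      of_real x powr (- (s + of_nat (Suc k))) * (\<Sum>n. c (Suc k) n * (1 / of_real x) ^ n)"
    if "x > 0" for x
  proof -
    \<comment> \<open>The formula for the previous iterate is known only on the positive half-line;
      that set is open, so it still determines the derivative at x.\<close>
    have "(?g has_vector_derivative
       - (of_real x powr (- (s + of_nat k + 1)) * (\<Sum>n. c (Suc k) n * (1 / of_real x) ^ n))) (at x)"
      unfolding c_Suc
      by (rule has_vector_derivative_transform_within_open
            [OF has_vector_derivative_power_series_inverse[OF IH that], of "{0<..}"])
         (use that Suc.IH in auto)
    thus ?thesis by (simp add: vector_derivative_at add_ac)
  qed
  moreover have "summable (\<lambda>n. c (Suc k) n * z ^ n)" for z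
    unfolding c_Suc by (rule sums_summable[OF sums_add_of_nat_times_power_series[OF IH]])
  ultimately show ?case by simp
qed

section \<open>The Bessel series and its Fox-Wright form\<close>

lemma prod_list_map_upt_Suc: "prod_list (map f [1..<Suc m]) = (\<Prod>j=1..m. f j)"
  by (subst prod.distinct_set_conv_list [symmetric])
     (simp_all add: atLeastLessThanSuc_atLeastAtMost del: upt_Suc)

theorem theorem4:
  fixes m :: nat and \<alpha> \<beta> :: "nat \<Rightarrow> complex" and \<gamma> b c lam \<delta> :: complex and \<kappa> x :: real
  assumes "\<kappa> > 0"
    and "(\<Sum>j=1..m. Re (\<alpha> j)) > max 0 (\<kappa> - 1)"
    and "\<And>j. j \<in> {1..m} \<Longrightarrow> Re (\<beta> j) > 0"
    and "Re \<gamma> > 0"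
    and "Re lam > 0"
    and "Re \<delta> > of_int \<lfloor>Re lam\<rfloor> + 1 - Re lam"
    and "x > 0"
  shows "RL_deriv_right lam
           (\<lambda>t. of_real t powr (- \<delta>) * multiindex_bessel m \<alpha> \<beta> (of_real \<kappa>) b \<gamma> c (1 / of_real t)) x
         = of_real x powr (- lam - \<delta>) / Gamma \<gamma>
           * fox_wright [(\<gamma>, of_real \<kappa>), (lam + \<delta>, 1)]
               (map (\<lambda>j. (\<beta> j + (b + 1) / 2, \<alpha> j)) [1..<Suc m] @ [(\<delta>, 1)])
               (c / of_real x)"
proof -
  define a where "a = (\<lambda>n. c ^ n * gen_pochhammer \<gamma> (of_real \<kappa> * of_nat n)
            * (\<Prod>j=1..m. rGamma (\<alpha> j * of_nat n + \<beta> j + (b + 1) / 2)) / fact n)"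
  define \<mu> where "\<mu> = 1 - lam + of_int \<lfloor>Re lam\<rfloor>"
  define k where "k = nat (\<lfloor>Re lam\<rfloor> + 1)"
  define d where "d = (\<lambda>n. a n * Gamma (\<delta> - \<mu> + of_nat n) / Gamma (\<delta> + of_nat n))"
  define f where "f = (\<lambda>t::real. of_real t powr (- \<delta>) * (\<Sum>n. a n * (1 / of_real t) ^ n))"
  have "Re \<mu> = 1 - Re lam + of_int \<lfloor>Re lam\<rfloor>"
    by (simp add: \<mu>_def)
  \<comment> \<open>Re \<mu> is one minus the fractional part of Re \<open>lam\<close>, hence
    positive; the hypothesis on Re \<delta> says exactly that it exceeds Re \<mu>, the convergence
    condition of the Beta integral.\<close>
  hence \<mu>: "Re \<mu> > 0" "Re \<delta> > Re \<mu>"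
    using assms(6) by linarith+
  have k: "of_nat k = (of_int \<lfloor>Re lam\<rfloor> + 1 :: complex)"
    using \<open>Re lam > 0\<close> by (simp add: k_def of_nat_nat)
  have "Gamma \<gamma> \<noteq> 0"
    using \<open>Re \<gamma> > 0\<close> by (auto simp: Gamma_eq_zero_iff elim!: nonpos_Ints_cases)
  have a_summable: "summable (\<lambda>n. norm (a n * z ^ n))" for z
  proof -
    have "summable (\<lambda>n. norm (Gamma (of_real \<kappa> * of_nat n + \<gamma>) *
            (\<Prod>j=1..m. rGamma (\<alpha> j * of_nat n + (\<beta> j + (b + 1) / 2))) / fact n * (c * z) ^ n) / norm (Gamma \<gamma>))"
      using assms(1,2) by (intro summable_divide summable_Gamma_quotient_power_series) auto
    thus ?thesis
      by (simp add: a_def gen_pochhammer_def norm_mult norm_divide power_mult_distrib add_ac mult_ac)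
  qed
  have f: "(\<lambda>t. of_real t powr (- \<delta>) * multiindex_bessel m \<alpha> \<beta> (of_real \<kappa>) b \<gamma> c (1 / of_real t)) = f"
    by (simp add: f_def multiindex_bessel_def a_def)
  have I_sums: "(\<lambda>n. d n * (1 / of_real y) ^ n) sums (RL_integral_right \<mu> f y / of_real y powr (\<mu> - \<delta>))"
    if "y > 0" for y :: real
    unfolding d_def f_def using a_summable \<mu> that by (rule RL_integral_right_power_series)
  \<comment> \<open>No new Gamma estimate is made: the fractional integral at y = 1 / r gives
    convergence at the real point r > norm z, and a power series converges inside that
    radius.\<close>
  have d_summable: "summable (\<lambda>n. d n * z ^ n)" for z
  proof -
    define r where "r = norm z + 1"
    have r: "r > 0" "norm z < r"
      using norm_ge_zero[of z] by (auto simp: r_def simp del: norm_ge_zero)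
    have "summable (\<lambda>n. d n * of_real r ^ n)"
      using I_sums[of "1 / r"] r by (simp add: sums_iff)
    thus ?thesis
      by (rule powser_inside) (use r in simp)
  qed
  have RL_integral: "RL_integral_right \<mu> f y = of_real y powr (- (\<delta> - \<mu>)) * (\<Sum>n. d n * (1 / of_real y) ^ n)"
    if "y > 0" for y
    using I_sums[OF that] that by (simp add: sums_iff)
  define e where "e = (\<lambda>n. pochhammer (\<delta> - \<mu> + of_nat n) k * d n)"
  note iterated = iterated_neg_vector_derivative_power_series[OF d_summable RL_integral, of k]
  have e_summable: "summable (\<lambda>n. e n * z ^ n)" for z
    using iterated by (simp add: e_def)
  have "RL_deriv_right lam f x = of_real x powr (- (\<delta> - \<mu> + of_nat k)) * (\<Sum>n. e n * (1 / of_real x) ^ n)"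
    using iterated \<open>x > 0\<close> by (simp add: RL_deriv_right_def e_def k_def \<mu>_def)
  \<comment> \<open>Integration of order \<mu> raises the exponent -\<delta> by \<mu>, and k
    differentiations lower it by k. Since k - \<mu> = \<open>lam\<close>, the resulting power is
    exactly - \<open>lam\<close> - \<delta>, with no additional 1.\<close>
  also have "- (\<delta> - \<mu> + of_nat k) = - lam - \<delta>"
    unfolding k \<mu>_def by simp
  also have "(\<Sum>n. e n * (1 / of_real x) ^ n) = fox_wright [(\<gamma>, of_real \<kappa>), (lam + \<delta>, 1)]
               (map (\<lambda>j. (\<beta> j + (b + 1) / 2, \<alpha> j)) [1..<Suc m] @ [(\<delta>, 1)]) (c / of_real x) / Gamma \<gamma>"
  proof -
    \<comment> \<open>The Pochhammer symbol is Gamma (\<delta> - \<mu> + n + k) / Gamma (\<delta> -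
      \<mu> + n). Its denominator, finite and nonzero since the argument has positive real part,
      cancels the numerator left by the integral, and \<delta> - \<mu> + k = \<open>lam\<close> +
      \<delta>.\<close>
    have e_eq: "e n = a n * Gamma (lam + \<delta> + of_nat n) * rGamma (\<delta> + of_nat n)" for n
    proof -
      have "\<delta> - \<mu> + of_nat n \<notin> \<int>\<^sub>\<le>\<^sub>0"
        using \<mu> by (auto elim!: nonpos_Ints_cases simp: complex_eq_iff)
      hence "pochhammer (\<delta> - \<mu> + of_nat n) k = Gamma (lam + \<delta> + of_nat n) / Gamma (\<delta> - \<mu> + of_nat n)"
        and "Gamma (\<delta> - \<mu> + of_nat n) \<noteq> 0"
        using k by (simp_all add: pochhammer_Gamma \<mu>_def Gamma_eq_zero_iff algebra_simps)
      thus ?thesis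
        by (simp add: e_def d_def rGamma_inverse_Gamma field_simps)
    qed
    have "fox_wright [(\<gamma>, of_real \<kappa>), (lam + \<delta>, 1)]
               (map (\<lambda>j. (\<beta> j + (b + 1) / 2, \<alpha> j)) [1..<Suc m] @ [(\<delta>, 1)]) (c / of_real x)
          = (\<Sum>n. Gamma \<gamma> * (e n * (1 / of_real x) ^ n))"
      unfolding fox_wright_def
    proof (rule suminf_cong)
      fix n
      have prods: "prod_list (map (\<lambda>(b, B). rGamma (b + B * of_nat n))
              (map (\<lambda>j. (\<beta> j + (b + 1) / 2, \<alpha> j)) [1..<Suc m] @ [(\<delta>, 1)]))
            = (\<Prod>j=1..m. rGamma (\<alpha> j * of_nat n + \<beta> j + (b + 1) / 2)) * rGamma (\<delta> + of_nat n)"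
        using prod_list_map_upt_Suc[of "\<lambda>j. rGamma (\<beta> j + (b + 1) / 2 + \<alpha> j * of_nat n)" m]
        by (simp add: o_def add_ac del: upt_Suc)
      thus "prod_list (map (\<lambda>(a, A). Gamma (a + A * of_nat n)) [(\<gamma>, of_real \<kappa>), (lam + \<delta>, 1)])
            * prod_list (map (\<lambda>(b, B). rGamma (b + B * of_nat n))
              (map (\<lambda>j. (\<beta> j + (b + 1) / 2, \<alpha> j)) [1..<Suc m] @ [(\<delta>, 1)])) * ((c / of_real x) ^ n / fact n)
          = Gamma \<gamma> * (e n * (1 / of_real x) ^ n)"
        unfolding prods using \<open>Gamma \<gamma> \<noteq> 0\<close> \<open>x > 0\<close>
        by (simp add: e_eq a_def gen_pochhammer_def power_divide mult_ac del: upt_Suc)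
    qed
    also have "\<dots> = Gamma \<gamma> * (\<Sum>n. e n * (1 / of_real x) ^ n)"
      by (rule suminf_mult) (rule e_summable)
    finally show ?thesis using \<open>Gamma \<gamma> \<noteq> 0\<close> by simp
  qed
  finally show ?thesis unfolding f by simp
qed

end
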